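(* Let $\boldsymbol w^*\in\mathcal S$ be a maximizer of the dual problem $\max_{\boldsymbol w\in\mathcal S}d(\boldsymbol w)$, and let $(\boldsymbol a^*,\boldsymbol b^* )$ be an associated solution of the minimization defining $d(\boldsymbol w^* )$ (achieving the minimum $d(\boldsymbol w^* )$), where $\boldsymbol a^*$ consists of coefficient vectors $\boldsymbol a^*_{ij}\in\mathbb C^{n_{ij}+1}$. Let $R^*(x)=[r^*_{ij}(x)]$ with $r^*_{ij}=p^*_{ij}/q^*$, where $p^*_{ij}(x)=[\psi_0(x),\dots,\psi_{n_{ij}}(x)]\boldsymbol a^*_{ij}$ and $q^*(x)=[\phi_0(x),\dots,\phi_d(x)]\boldsymbol b^*$. Suppose $q^*(x_\ell)\neq0$ for all $x_\ell\in\mathcal X$. If $$d(\boldsymbol w^* )=\max_{x_\ell\in\mathcal X}\|F(x_\ell)-R^*(x_\ell)\|_{\mathrm F}^2,$$ then strong duality holds, i.e. $\max_{\boldsymbol w\in\mathcal S}d(\boldsymbol w)=\eta_\infty$, and $R^*$ is a global solution of the minimax problem $\eta_\infty=\inf_{R\in\mathscr R_{(s,t)}}\max_{1\le\ell\le m}\|F(x_\ell)-R(x_\ell)\|_{\mathrm F}^2$.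
   Context: $s,t\ge1$ and $d,n_{ij}\ge0$ are given integers; $\mathbb P_n$ is the set of complex polynomials of degree at most $n$; $\mathcal X=\{x_\ell\}_{\ell=1}^m\subset\mathbb C$ are distinct nodes with $m\ge\max_{i,j}\{n_{ij}+d+2\}$; $F(x_\ell)=[f_{ij}(x_\ell)]\in\mathbb C^{s\times t}$ are given data; $\|\cdot\|_{\mathrm F}$ is the Frobenius norm. $\mathscr R_{(s,t)}$ is the set of $R=[r_{ij}]$ of size $s\times t$ with $r_{ij}=p_{ij}/q$, $p_{ij}\in\mathbb P_{n_{ij}}$, common denominator $0\not\equiv q\in\mathbb P_d$. If $q$ vanishes at a node, values of $R$ there are understood after cancelling common zeros; if a pole remains at a node the error there is $+\infty$. $\{\psi_0,\dots,\psi_{n_{ij}}\}$ is a basis of $\mathbb P_{n_{ij}}$ for each $(i,j)$ and $\{\phi_0,\dots,\phi_d\}$ a basis of $\mathbb P_d$ (e.g. monomials). $\mathcal S=\{\boldsymbol w\in\mathbb R^m:\boldsymbol w\ge0,\sum_\ell w_\ell=1\}$, and $$d(\boldsymbol w)=\min\Big\{\sum_{\ell=1}^m w_\ell\sum_{i=1}^s\sum_{j=1}^t|f_{ij}(x_\ell)q(x_\ell)-p_{ij}(x_\ell)|^2:\ p_{ij}\in\mathbb P_{n_{ij}},\ q\in\mathbb P_d,\ \sum_{\ell=1}^m w_\ell|q(x_\ell)|^2=1\Big\},$$ the minimization being over the coefficient vectors $\boldsymbol a_{ij}\in\mathbb C^{n_{ij}+1}$ of $p_{ij}$ in the basis $\{\psi_0,\dots,\psi_{n_{ij}}\}$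 and $\boldsymbol b\in\mathbb C^{d+1}$ of $q$ in the basis $\{\phi_0,\dots,\phi_d\}$. *)

theory Defs
  imports
    "HOL-Analysis.Analysis"
    "HOL-Computational_Algebra.Computational_Algebra"
    "HOL-Computational_Algebra.Field_as_Ring"
begin

text \<open>Rational functions are elements of the field of fractions of \<open>complex poly\<close>.
  The function \<open>quot_of_fract\<close> returns the reduced (coprime) representation, so the value and
  the poles below are those obtained after cancelling all common zeros.\<close>

definition rat_has_pole :: "complex poly fract \<Rightarrow> complex \<Rightarrow> bool" where
  "rat_has_pole r z \<longleftrightarrow> poly (snd (quot_of_fract r)) z = 0"

definition rat_value :: "complex poly fract \<Rightarrow> complex \<Rightarrow> complex" where
  "rat_value r z = poly (fst (quot_of_fract r)) z / poly (snd (quot_of_fract r)) z"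

definition rat_class :: "('s::finite \<Rightarrow> 't::finite \<Rightarrow> nat) \<Rightarrow> nat \<Rightarrow> (complex poly fract ^ 't ^ 's) set" where
  "rat_class n d = {R. \<exists>p q. q \<noteq> 0 \<and> degree q \<le> d \<and>
     (\<forall>i j. degree (p i j) \<le> n i j \<and> R $ i $ j = Fract (p i j) q)}"

text \<open>The library norm on \<open>complex ^ 't ^ 's\<close> is the Frobenius norm:\<close>

lemma norm_eq_Frobenius:
  fixes A :: "complex ^ 't::finite ^ 's::finite"
  shows "norm A = sqrt (\<Sum>i\<in>UNIV. \<Sum>j\<in>UNIV. (cmod (A $ i $ j))\<^sup>2)"
  by (simp add: norm_vec_def L2_set_def sum_nonneg)

definition sq_error ::
    "(complex \<Rightarrow> complex ^ 't ^ 's) \<Rightarrow> complex poly fract ^ 't::finite ^ 's::finite \<Rightarrow> complex \<Rightarrow> ereal" where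
  "sq_error F R z =
     (if \<exists>i j. rat_has_pole (R $ i $ j) z then \<infinity>
      else ereal ((norm (F z - (\<chi> i j. rat_value (R $ i $ j) z)))\<^sup>2))"

definition max_sq_error ::
    "('m::finite \<Rightarrow> complex) \<Rightarrow> (complex \<Rightarrow> complex ^ 't ^ 's)
      \<Rightarrow> complex poly fract ^ 't::finite ^ 's::finite \<Rightarrow> ereal" where
  "max_sq_error x F R = Max (range (\<lambda>l. sq_error F R (x l)))"

definition minimax_value ::
    "('m::finite \<Rightarrow> complex) \<Rightarrow> (complex \<Rightarrow> complex ^ 't ^ 's)
      \<Rightarrow> ('s::finite \<Rightarrow> 't::finite \<Rightarrow> nat) \<Rightarrow> nat \<Rightarrow> ereal" where
  "minimax_value x F n d = (INF R\<in>rat_class n d. max_sq_error x F R)"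

text \<open>The span and linear dependence are those of the \<open>\<complex>\<close>-vector space of polynomials:\<close>

lemma vector_space_smult: "vector_space (smult :: complex \<Rightarrow> complex poly \<Rightarrow> complex poly)"
  by unfold_locales (simp_all add: smult_add_right smult_add_left)

definition poly_basis :: "(nat \<Rightarrow> complex poly) \<Rightarrow> nat \<Rightarrow> bool" where
  "poly_basis \<psi> n \<longleftrightarrow> inj_on \<psi> {..n} \<and> \<not> module.dependent smult (\<psi> ` {..n}) \<and>
     module.span smult (\<psi> ` {..n}) = {p. degree p \<le> n}"

text \<open>A coefficient vector in \<open>\<complex>\<close>-space of dimension \<open>n + 1\<close> is a function on \<open>nat\<close> of which only
  the values at \<open>0, \<dots>, n\<close> are ever used.\<close>

definition poly_comb :: "(nat \<Rightarrow> complex poly) \<Rightarrow> nat \<Rightarrow> (nat \<Rightarrow> complex) \<Rightarrow> complex poly" where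
  "poly_comb \<psi> n c = (\<Sum>k\<le>n. smult (c k) (\<psi> k))"

definition weight_simplex :: "(real ^ 'm::finite) set" where
  "weight_simplex = {w. (\<forall>l. 0 \<le> w $ l) \<and> (\<Sum>l\<in>UNIV. w $ l) = 1}"

definition dual_objective ::
    "('m::finite \<Rightarrow> complex) \<Rightarrow> (complex \<Rightarrow> complex ^ 't ^ 's)
      \<Rightarrow> ('s::finite \<Rightarrow> 't::finite \<Rightarrow> nat) \<Rightarrow> nat
      \<Rightarrow> (nat \<Rightarrow> complex poly) \<Rightarrow> (nat \<Rightarrow> complex poly) \<Rightarrow> real ^ 'm
      \<Rightarrow> ('s \<Rightarrow> 't \<Rightarrow> nat \<Rightarrow> complex) \<times> (nat \<Rightarrow> complex) \<Rightarrow> real" where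
  "dual_objective x F n d \<psi> \<phi> w = (\<lambda>(a, b).
     \<Sum>l\<in>UNIV. w $ l * (\<Sum>i\<in>UNIV. \<Sum>j\<in>UNIV.
       (cmod (F (x l) $ i $ j * poly (poly_comb \<phi> d b) (x l)
              - poly (poly_comb \<psi> (n i j) (a i j)) (x l)))\<^sup>2))"

definition dual_feasible ::
    "('m::finite \<Rightarrow> complex) \<Rightarrow> nat \<Rightarrow> (nat \<Rightarrow> complex poly) \<Rightarrow> real ^ 'm
      \<Rightarrow> ('s \<Rightarrow> 't \<Rightarrow> nat \<Rightarrow> complex) \<times> (nat \<Rightarrow> complex) \<Rightarrow> bool" where
  "dual_feasible x d \<phi> w = (\<lambda>(a, b).
     (\<Sum>l\<in>UNIV. w $ l * (cmod (poly (poly_comb \<phi> d b) (x l)))\<^sup>2) = 1)"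

text \<open>For weights in the simplex this infimum is attained, i.e. it is a minimum.\<close>

definition dual_fun ::
    "('m::finite \<Rightarrow> complex) \<Rightarrow> (complex \<Rightarrow> complex ^ 't ^ 's)
      \<Rightarrow> ('s::finite \<Rightarrow> 't::finite \<Rightarrow> nat) \<Rightarrow> nat
      \<Rightarrow> (nat \<Rightarrow> complex poly) \<Rightarrow> (nat \<Rightarrow> complex poly) \<Rightarrow> real ^ 'm \<Rightarrow> real" where
  "dual_fun x F n d \<psi> \<phi> w =
     Inf (dual_objective x F n d \<psi> \<phi> w ` Collect (dual_feasible x d \<phi> w))"

end

theory Submission
  imports Defs
begin

text \<open>Weak duality suffices, as \<open>R\<^sup>*\<close> attains the bound given by \<open>w\<^sup>*\<close>. A rational matrix without poles at the nodes
  has a representation whose denominator does not vanish at any node; rescaled so that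
  \<open>\<Sum>w\<^sub>l \<bar>q(x\<^sub>l)\<bar>\<^sup>2 = 1\<close>, it is feasible for \<open>d(w)\<close> with an objective that is a convex combination
  of its squared errors, so \<open>d(w)\<close> is at most the maximal one.\<close>

lemma poly_comb_scale: "poly_comb \<psi> n (\<lambda>k. c * a k) = smult c (poly_comb \<psi> n a)"
  unfolding poly_comb_def
  by (induction n) (simp_all add: smult_add_right)

text \<open>The span of a finite set consists of its linear combinations, and injectivity of
  \<open>\<psi>\<close> turns sums over the image set into sums over indices. This gives every
  polynomial of admissible degree a coefficient vector, and bounds the degree of every
  combination.\<close>

lemma poly_basis_range:
  assumes "poly_basis \<psi> n"
  shows "range (poly_comb \<psi> n) = {p. degree p \<le> n}"
proof -
  interpret vector_space "smult :: complex \<Rightarrow> complex poly \<Rightarrow> complex poly"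
    by (rule vector_space_smult)
  have inj: "inj_on \<psi> {..n}" and span: "span (\<psi> ` {..n}) = {p. degree p \<le> n}"
    using assms by (auto simp: poly_basis_def)
  have reindex: "(\<Sum>v\<in>\<psi> ` {..n}. smult (u v) v) = poly_comb \<psi> n (u \<circ> \<psi>)" for u
    using inj by (simp add: poly_comb_def sum.reindex)
  \<comment> \<open>Span coefficients are attached to vectors, not to indices;
    \<open>inv_into\<close> carries an arbitrary \<open>c\<close> over to the vectors, so each
    combination is of the form in \<open>reindex\<close>.\<close>
  have "poly_comb \<psi> n c = poly_comb \<psi> n ((c \<circ> inv_into {..n} \<psi>) \<circ> \<psi>)" for c
    using inj by (simp add: poly_comb_def)
  then have "range (poly_comb \<psi> n) = range (\<lambda>u. \<Sum>v\<in>\<psi> ` {..n}. smult (u v) v)"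
    unfolding reindex by blast
  also have "\<dots> = span (\<psi> ` {..n})"
    by (simp add: span_finite)
  finally show ?thesis
    using span by simp
qed

text \<open>Cross-multiplication of equal fractions ties an arbitrary representation to the reduced
  one, through which poles and values are defined.\<close>

lemma quot_of_fract_cross:
  fixes p q :: "complex poly"
  assumes "q \<noteq> 0"
  shows "p * snd (quot_of_fract (Fract p q)) = fst (quot_of_fract (Fract p q)) * q"
proof -
  have "Fract (fst (quot_of_fract (Fract p q))) (snd (quot_of_fract (Fract p q))) = Fract p q"
    by (rule Fract_quot_of_fract)
  then show ?thesis
    using assms by (simp only: eq_fract(1) snd_quot_of_fract_nonzero not_False_eq_True)
qed

lemma poly_quot_of_fract_cross:
  fixes p q :: "complex poly"
  assumes "q \<noteq> 0"
  shows "poly p z * poly (snd (quot_of_fract (Fract p q))) z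
    = poly (fst (quot_of_fract (Fract p q))) z * poly q z"
  using arg_cong[OF quot_of_fract_cross[OF assms, of p], of "\<lambda>r. poly r z"] by simp

lemma rat_value_Fract:
  assumes "poly q z \<noteq> 0" and "\<not> rat_has_pole (Fract p q) z"
  shows "rat_value (Fract p q) z = poly p z / poly q z"
proof -
  have "q \<noteq> 0"
    using assms(1) by auto
  from poly_quot_of_fract_cross[OF this, of p z] assms show ?thesis
    by (simp add: rat_value_def rat_has_pole_def field_simps)
qed

text \<open>After cross-multiplication the side containing \<open>poly q z\<close> vanishes, while
  the reduced denominator on the other side does not.\<close>

lemma numerator_zero_if_no_pole:
  assumes "q \<noteq> 0" and "poly q z = 0" and "\<not> rat_has_pole (Fract p q) z"
  shows "poly p z = 0"
  using poly_quot_of_fract_cross[OF assms(1), of p z] assms(2,3)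
  by (simp add: rat_has_pole_def)

text \<open>In a representation with denominator of least degree, a zero of the denominator at a point
  where no entry has a pole would be a common zero, and hence could be cancelled.\<close>

lemma rat_class_nonvanishing_denominator:
  fixes R :: "complex poly fract ^ 't::finite ^ 's::finite"
  assumes "R \<in> rat_class n d"
    and no_pole: "\<And>z i j. z \<in> Z \<Longrightarrow> \<not> rat_has_pole (R $ i $ j) z"
  obtains q p where "q \<noteq> 0" "degree q \<le> d" "\<And>i j. degree (p i j) \<le> n i j"
    "\<And>i j. R $ i $ j = Fract (p i j) q" "\<And>z. z \<in> Z \<Longrightarrow> poly q z \<noteq> 0"
proof -
  define rep where "rep = (\<lambda>(p, q). q \<noteq> 0 \<and> degree q \<le> d \<and>
    (\<forall>i j. degree (p i j) \<le> n i j \<and> R $ i $ j = Fract (p i j) q))"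
  obtain r where "rep r"
    using assms(1) by (auto simp: rat_class_def rep_def)
  then obtain p q where pq: "rep (p, q)"
    and least: "\<And>p' q'. rep (p', q') \<Longrightarrow> degree q \<le> degree q'"
    using ex_has_least_nat[of rep r "\<lambda>(p, q). degree q"] by auto
  have q: "q \<noteq> 0" "degree q \<le> d"
    and p: "degree (p i j) \<le> n i j" "R $ i $ j = Fract (p i j) q" for i j
    using pq by (auto simp: rep_def)
  have "poly q z \<noteq> 0" if z: "z \<in> Z" for z
  proof
    assume zero: "poly q z = 0"
    let ?c = "[:-z, 1:]"
    obtain q' where q': "q = ?c * q'"
      using zero by (auto simp: poly_eq_0_iff_dvd)
    \<comment> \<open>All numerators vanish at \<open>z\<close>, so the same linear factor leaves
      every entry and the quotients still share one denominator.\<close>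
    have "\<exists>r. p i j = ?c * r" for i j
      using numerator_zero_if_no_pole[OF q(1) zero] no_pole[OF z] p(2)[of i j]
      by (metis dvd_def poly_eq_0_iff_dvd)
    then obtain p' where p': "\<And>i j. p i j = ?c * p' i j"
      by metis
    have "q' \<noteq> 0"
      using q(1) q' by auto
    then have deg: "degree q = Suc (degree q')"
      by (simp add: q' degree_mult_eq del: mult_pCons_left)
    \<comment> \<open>Degrees add only for nonzero factors, hence the separate case of a zero
      numerator.\<close>
    have "degree (p' i j) \<le> degree (p i j)" for i j
      by (cases "p' i j = 0") (simp_all add: p' degree_mult_eq del: mult_pCons_left)
    then have "degree (p' i j) \<le> n i j" for i j
      using p(1) order_trans by blast
    moreover have "R $ i $ j = Fract (p' i j) q'" for i j
      using \<open>q' \<noteq> 0\<close> q(1) unfolding p(2)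
      by (simp add: eq_fract p'[of i j] q' del: mult_pCons_left)
    ultimately have "rep (p', q')"
      using \<open>q' \<noteq> 0\<close> q(2) deg by (simp add: rep_def)
    from least[OF this] deg show False
      by simp
  qed
  with that q p show thesis
    by blast
qed

lemma norm_matrix_power2:
  fixes A :: "complex ^ 't::finite ^ 's::finite"
  shows "(norm A)\<^sup>2 = (\<Sum>i\<in>UNIV. \<Sum>j\<in>UNIV. (cmod (A $ i $ j))\<^sup>2)"
  by (simp add: norm_eq_Frobenius sum_nonneg)

text \<open>A real \<open>Inf\<close> is a lower bound only of sets that are bounded below;
  nonnegative weights supply the bound 0.\<close>

lemma dual_fun_le_objective:
  assumes "w \<in> weight_simplex" and "dual_feasible x d \<phi> w ab"
  shows "dual_fun x F n d \<psi> \<phi> w \<le> dual_objective x F n d \<psi> \<phi> w ab"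
  unfolding dual_fun_def
proof (rule cInf_lower)
  show "bdd_below (dual_objective x F n d \<psi> \<phi> w ` Collect (dual_feasible x d \<phi> w))"
    using assms(1)
    by (intro bdd_belowI[where m = 0])
      (auto simp: dual_objective_def weight_simplex_def intro!: sum_nonneg mult_nonneg_nonneg)
qed (use assms(2) in auto)

lemma sq_error_le_max: "sq_error F R (x l) \<le> max_sq_error x F R"
  unfolding max_sq_error_def by (rule Max_ge) auto

lemma weak_duality:
  fixes F :: "complex \<Rightarrow> complex ^ 't::finite ^ 's::finite"
    and R :: "complex poly fract ^ 't ^ 's" and w :: "real ^ 'm::finite"
  assumes w: "w \<in> weight_simplex"
    and psi: "\<And>i j. poly_basis \<psi> (n i j)" and phi: "poly_basis \<phi> d"
    and R: "R \<in> rat_class n d"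
  shows "ereal (dual_fun x F n d \<psi> \<phi> w) \<le> max_sq_error x F R"
proof (cases "\<exists>l i j. rat_has_pole (R $ i $ j) (x l)")
  case True
  then obtain l where "\<exists>i j. rat_has_pole (R $ i $ j) (x l)"
    by blast
  then have "sq_error F R (x l) = \<infinity>"
    by (simp only: sq_error_def if_True)
  with sq_error_le_max[of F R x l] show ?thesis
    by simp
next
  case False
  then have no_pole: "\<not> rat_has_pole (R $ i $ j) z" if "z \<in> range x" for z i j
    using that by auto
  obtain q p where "q \<noteq> 0" and degq: "degree q \<le> d" and degp: "\<And>i j. degree (p i j) \<le> n i j"
    and Rij: "\<And>i j. R $ i $ j = Fract (p i j) q" and "\<And>z. z \<in> range x \<Longrightarrow> poly q z \<noteq> 0"
    by (rule rat_class_nonvanishing_denominator[OF R no_pole]) blast+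
  then have qx: "poly q (x l) \<noteq> 0" for l
    by blast
  define e where "e l = (norm (F (x l) - (\<chi> i j. rat_value (R $ i $ j) (x l))))\<^sup>2" for l
  \<comment> \<open>The estimate is carried out in the reals. Since \<open>M\<close> is itself one
    of the errors, it stays below the extended-real maximum.\<close>
  define M where "M = Max (range e)"
  have sq: "sq_error F R (x l) = ereal (e l)" for l
    using False by (simp add: sq_error_def e_def)
  have "e l \<le> M" for l
    by (simp add: M_def)
  have "M \<in> range e"
    unfolding M_def by (rule Max_in) auto
  then have M: "ereal M \<le> max_sq_error x F R"
    using sq_error_le_max sq by (metis imageE)
  have w0: "w $ l \<ge> 0" and w1: "(\<Sum>l\<in>UNIV. w $ l) = 1" for l
    using w by (auto simp: weight_simplex_def)
  define S where "S = (\<Sum>l\<in>UNIV. w $ l * (cmod (poly q (x l)))\<^sup>2)"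
  \<comment> \<open>Weights may vanish at some nodes, but not at all; as \<open>q\<close> is nonzero
    at every node, one positive weight makes \<open>S\<close> positive.\<close>
  have "\<exists>l. w $ l \<noteq> 0"
    using w1 by (metis sum.neutral zero_neq_one)
  then obtain l0 where "w $ l0 > 0"
    using w0 by (metis order_le_less)
  then have "S > 0"
    unfolding S_def using w0 qx by (intro sum_pos2[where i = l0]) auto
  \<comment> \<open>This factor normalizes the weighted square sum of \<open>q\<close> to 1; applied
    to numerators and denominator alike it leaves every quotient unchanged.\<close>
  define c where "c = complex_of_real (1 / sqrt S)"
  have c: "(cmod c)\<^sup>2 = 1 / S"
    using \<open>S > 0\<close> by (simp add: c_def norm_divide power_divide)
  have "q \<in> range (poly_comb \<phi> d)" "p i j \<in> range (poly_comb \<psi> (n i j))" for i j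
    using degq degp by (auto simp: poly_basis_range[OF phi] poly_basis_range[OF psi])
  then obtain b a where b: "q = poly_comb \<phi> d b"
    and a: "\<And>i j. p i j = poly_comb \<psi> (n i j) (a i j)"
    unfolding image_iff by metis
  let ?ab = "(\<lambda>i j k. c * a i j k, \<lambda>k. c * b k)"
  have feasible: "dual_feasible x d \<phi> w ?ab"
    using \<open>S > 0\<close> unfolding dual_feasible_def
    by (simp add: poly_comb_scale b[symmetric] norm_mult power_mult_distrib c S_def
        sum_divide_distrib[symmetric])
  \<comment> \<open>Pulling \<open>c * q\<close> out of the linearized residual leaves the true
    error, because no denominator vanishes at a node.\<close>
  have residual: "(\<Sum>i\<in>UNIV. \<Sum>j\<in>UNIV. (cmod (F (x l) $ i $ j * (c * poly q (x l)) - c * poly (p i j) (x l)))\<^sup>2)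
      = (cmod (poly q (x l)))\<^sup>2 / S * e l" for l
  proof -
    have "F (x l) $ i $ j * (c * poly q (x l)) - c * poly (p i j) (x l)
        = c * poly q (x l) * (F (x l) $ i $ j - rat_value (R $ i $ j) (x l))" for i j
      using False qx Rij by (simp add: rat_value_Fract field_simps)
    then show ?thesis
      by (simp add: e_def norm_matrix_power2 norm_mult power_mult_distrib c sum_distrib_left)
  qed
  have "dual_fun x F n d \<psi> \<phi> w \<le> dual_objective x F n d \<psi> \<phi> w ?ab"
    by (rule dual_fun_le_objective[OF w feasible])
  also have "\<dots> = (\<Sum>l\<in>UNIV. w $ l * ((cmod (poly q (x l)))\<^sup>2 / S * e l))"
    unfolding dual_objective_def
    by (simp add: poly_comb_scale b[symmetric] a[symmetric] residual)
  \<comment> \<open>The factors \<open>w $ l * (cmod (poly q (x l)))\<^sup>2 / S\<close> are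
    nonnegative and sum to 1, so replacing each error by \<open>M\<close> collapses the sum to
    \<open>M\<close>.\<close>
  also have "\<dots> \<le> (\<Sum>l\<in>UNIV. w $ l * ((cmod (poly q (x l)))\<^sup>2 / S * M))"
    using w0 \<open>S > 0\<close> \<open>\<And>l. e l \<le> M\<close> by (intro sum_mono mult_left_mono) auto
  also have "\<dots> = (\<Sum>l\<in>UNIV. w $ l * (cmod (poly q (x l)))\<^sup>2) * (M / S)"
    by (simp add: sum_distrib_right sum_divide_distrib mult.assoc)
  also have "\<dots> = M"
    using \<open>S > 0\<close> by (simp add: S_def[symmetric])
  finally have "ereal (dual_fun x F n d \<psi> \<phi> w) \<le> ereal M"
    by simp
  with M show ?thesis
    by (rule order_trans[rotated])
qed

theorem theorem4p1:
  fixes x :: "'m::finite \<Rightarrow> complex"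
    and F :: "complex \<Rightarrow> complex ^ 't::finite ^ 's::finite"
    and n :: "'s \<Rightarrow> 't \<Rightarrow> nat" and d :: nat
    and \<psi> \<phi> :: "nat \<Rightarrow> complex poly"
    and w_star :: "real ^ 'm"
    and a_star :: "'s \<Rightarrow> 't \<Rightarrow> nat \<Rightarrow> complex" and b_star :: "nat \<Rightarrow> complex"
    and p_star :: "'s \<Rightarrow> 't \<Rightarrow> complex poly" and q_star :: "complex poly"
    and R_star :: "complex poly fract ^ 't ^ 's"
  assumes nodes_distinct: "inj x"
    and nodes_number: "\<And>i j. n i j + d + 2 \<le> CARD('m)"
    and psi_basis: "\<And>i j. poly_basis \<psi> (n i j)"
    and phi_basis: "poly_basis \<phi> d"
    and w_star_max: "is_arg_max (dual_fun x F n d \<psi> \<phi>) (\<lambda>w. w \<in> weight_simplex) w_star"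
    and min_attained:
      "is_arg_min (dual_objective x F n d \<psi> \<phi> w_star) (dual_feasible x d \<phi> w_star) (a_star, b_star)"
    and p_star_def: "p_star = (\<lambda>i j. poly_comb \<psi> (n i j) (a_star i j))"
    and q_star_def: "q_star = poly_comb \<phi> d b_star"
    and R_star_def: "R_star = (\<chi> i j. Fract (p_star i j) q_star)"
    and q_star_nonzero: "\<And>l. poly q_star (x l) \<noteq> 0"
    and dual_eq_error: "ereal (dual_fun x F n d \<psi> \<phi> w_star) = max_sq_error x F R_star"
  shows "(SUP w\<in>weight_simplex. ereal (dual_fun x F n d \<psi> \<phi> w)) = minimax_value x F n d
    \<and> is_arg_min (max_sq_error x F) (\<lambda>R. R \<in> rat_class n d) R_star"
proof -
  let ?D = "dual_fun x F n d \<psi> \<phi>"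
  have w: "w_star \<in> weight_simplex" and max: "\<And>w. w \<in> weight_simplex \<Longrightarrow> ?D w \<le> ?D w_star"
    using w_star_max by (auto simp: is_arg_max_def not_less)
  have "degree q_star \<le> d" "degree (p_star i j) \<le> n i j" for i j
    using poly_basis_range[OF phi_basis] poly_basis_range[OF psi_basis]
    unfolding p_star_def q_star_def by blast+
  moreover have "q_star \<noteq> 0"
    using q_star_nonzero by force
  ultimately have R: "R_star \<in> rat_class n d"
    by (auto simp: rat_class_def R_star_def)
  \<comment> \<open>Weak duality at \<open>w_star\<close> bounds every admissible error below by the
    dual value, which by \<open>dual_eq_error\<close> is the error of \<open>R_star\<close>.\<close>
  have lower: "max_sq_error x F R_star \<le> max_sq_error x F R" if "R \<in> rat_class n d" for R
    using weak_duality[OF w psi_basis phi_basis that, of x F] by (simp add: dual_eq_error)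
  have "(SUP w\<in>weight_simplex. ereal (?D w)) = ereal (?D w_star)"
    using w max by (intro antisym SUP_least SUP_upper) auto
  moreover have "minimax_value x F n d = max_sq_error x F R_star"
    unfolding minimax_value_def
    by (intro antisym INF_greatest INF_lower R lower)
  ultimately show ?thesis
    using R lower by (auto simp: dual_eq_error is_arg_min_def not_less)
qed

end
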